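(* Let $X$ be a compact metric space with $\mathrm{mst}$-spectrum $\sigma(X)=\{\sigma_1,\sigma_2,\ldots\}$. Let $k\in\mathbb{N}$ with $k+1\le\#X$, and let $0<\lambda<\operatorname{diam}X+\sigma_k$. Assume that $d_{k+1}(X)=\operatorname{diam}X$. Then $$2d_{GH}(\lambda\Delta_{k+1},X)=\operatorname{diam}X .$$
   Context: Here $\mathbb{N}=\{1,2,\ldots\}$, $\#X$ is the cardinality of $X$, $|xy|$ is the distance between points $x,y$, and $d_{GH}$ is the Gromov--Hausdorff distance. For $\lambda>0$ and $m\in\mathbb{N}$, $\lambda\Delta_m$ denotes the $m$-point metric space (simplex) all of whose nonzero distances equal $\lambda$. For nonempty $A,B\subset X$ put $|AB|=\inf\{|ab|:a\in A,\,b\in B\}$. $\mathcal{D}_k(X)$ is the family of all partitions of $X$ into $k$ nonempty subsets. For $D=\{X_1,\ldots,X_k\}\in\mathcal{D}_k(X)$ put $\operatorname{diam}D=\max_i\operatorname{diam}X_i$ and, if $k\ge2$, $\alpha(D)=\min\{|X_iX_j|:i\ne j\}$. For $k\in\mathbb{N}$ put $\sigma_k=\sup\{\alpha(D):D\in\mathcal{D}_{k+1}(X)\}$ if $\mathcal{D}_{k+1}(X)\neq\emptyset$, and $\sigma_k=0$ otherwise; $\sigma(X)=\{\sigma_1,\sigma_2,\ldots\}$ is the $\mathrm{mst}$-spectrum of $X$. Finally, $d_m(X)=\inf\{\operatorname{diam}D:D\in\mathcal{D}_m(X)\}$ if $\mathcal{D}_m(X)\ne\emptyset$, and $d_m(X)=\infty$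 otherwise. *)

theory Defs
  imports "HOL-Analysis.Analysis"
begin

section \<open>Hausdorff and Gromov--Hausdorff distance\<close>

text \<open>Spaces are given, as in \<^locale>\<open>Metric_space\<close>, by a carrier and a distance function.
  Both distances take values in \<^typ>\<open>ennreal\<close>, so that they are meaningful without any
  boundedness assumption.\<close>

definition hausdorff_distance :: "('c \<Rightarrow> 'c \<Rightarrow> real) \<Rightarrow> 'c set \<Rightarrow> 'c set \<Rightarrow> ennreal" where
  "hausdorff_distance d A B =
     max (SUP a\<in>A. INF b\<in>B. ennreal (d a b)) (SUP b\<in>B. INF a\<in>A. ennreal (d a b))"

definition isometric :: "'a set \<Rightarrow> ('a \<Rightarrow> 'a \<Rightarrow> real) \<Rightarrow> 'b set \<Rightarrow> ('b \<Rightarrow> 'b \<Rightarrow> real) \<Rightarrow> bool" where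
  "isometric X dX Y dY \<longleftrightarrow>
     (\<exists>f. bij_betw f X Y \<and> (\<forall>x\<in>X. \<forall>x'\<in>X. dY (f x) (f x') = dX x x'))"

definition realization ::
  "'a set \<Rightarrow> ('a \<Rightarrow> 'a \<Rightarrow> real) \<Rightarrow> 'b set \<Rightarrow> ('b \<Rightarrow> 'b \<Rightarrow> real) \<Rightarrow>
   'c set \<Rightarrow> ('c \<Rightarrow> 'c \<Rightarrow> real) \<Rightarrow> 'c set \<Rightarrow> 'c set \<Rightarrow> bool" where
  "realization X dX Y dY Z d X' Y' \<longleftrightarrow>
     Metric_space Z d \<and> X' \<subseteq> Z \<and> Y' \<subseteq> Z \<and> isometric X dX X' d \<and> isometric Y dY Y' d"

text \<open>The ambient space should range over all metric spaces, but HOL cannot quantify over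
  types inside a definition. Ambient spaces carried by subsets of the sum type suffice:
  any realization restricts to the union of the two copies, which injects into the sum type;
  see \<open>gromov_hausdorff_distance_le\<close> below. The copies may overlap.\<close>

definition gromov_hausdorff_distance ::
  "'a set \<Rightarrow> ('a \<Rightarrow> 'a \<Rightarrow> real) \<Rightarrow> 'b set \<Rightarrow> ('b \<Rightarrow> 'b \<Rightarrow> real) \<Rightarrow> ennreal" where
  "gromov_hausdorff_distance X dX Y dY =
     Inf {hausdorff_distance d X' Y' | (Z :: ('a + 'b) set) d X' Y'.
            realization X dX Y dY Z d X' Y'}"

lemma gromov_hausdorff_distance_le:
  fixes Z :: "'c set"
  assumes "realization X dX Y dY Z e A B"
  shows "gromov_hausdorff_distance X dX Y dY \<le> hausdorff_distance e A B"
proof -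
  obtain f g where ms: "Metric_space Z e" and AZ: "A \<subseteq> Z" and BZ: "B \<subseteq> Z"
    and f: "bij_betw f X A" "\<forall>x\<in>X. \<forall>x'\<in>X. e (f x) (f x') = dX x x'"
    and g: "bij_betw g Y B" "\<forall>x\<in>Y. \<forall>x'\<in>Y. e (g x) (g x') = dY x x'"
    using assms unfolding realization_def isometric_def by blast
  interpret Metric_space Z e by (rule ms)
  define W where "W = A \<union> B"
  have WZ: "W \<subseteq> Z" using AZ BZ by (simp add: W_def)
  define h :: "'c \<Rightarrow> 'a + 'b"
    where "h z = (if z \<in> A then Inl (inv_into X f z) else Inr (inv_into Y g z))" for z
  have fA: "f ` X = A" and gB: "g ` Y = B" using f g by (auto simp: bij_betw_def)
  have inj: "inj_on h W"
    unfolding inj_on_def W_def h_def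
    using fA gB by (auto split: if_splits intro: inv_into_injective)
  define p where "p = inv_into W h"
  have p [simp]: "p (h z) = z" if "z \<in> W" for z
    using inj that by (simp add: p_def)
  define d where "d u v = (if u \<in> h ` W \<and> v \<in> h ` W then e (p u) (p v) else 0)" for u v
  have d [simp]: "d (h x) (h y) = e x y" if "x \<in> W" "y \<in> W" for x y
    using that by (simp add: d_def)
  have "Metric_space (h ` W) d"
  proof
    show "0 \<le> d x y" for x y by (simp add: d_def)
    show "d x y = d y x" for x y by (simp add: d_def commute)
    show "d x y = 0 \<longleftrightarrow> x = y" if "x \<in> h ` W" "y \<in> h ` W" for x y
    proof -
      obtain a b where ab: "x = h a" "y = h b" "a \<in> W" "b \<in> W"
        using \<open>x \<in> h ` W\<close> \<open>y \<in> h ` W\<close> by blast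
      have "a \<in> Z" "b \<in> Z" using ab WZ by auto
      then show ?thesis using ab inj by (simp add: inj_on_eq_iff)
    qed
    show "d x z \<le> d x y + d y z" if "x \<in> h ` W" "y \<in> h ` W" "z \<in> h ` W" for x y z
    proof -
      obtain a b c where "x = h a" "y = h b" "z = h c" "a \<in> W" "b \<in> W" "c \<in> W"
        using \<open>x \<in> h ` W\<close> \<open>y \<in> h ` W\<close> \<open>z \<in> h ` W\<close> by blast
      moreover from this have "a \<in> Z" "b \<in> Z" "c \<in> Z" using WZ by auto
      ultimately show ?thesis by (simp add: triangle)
    qed
  qed
  moreover have "isometric X dX (h ` A) d"
    unfolding isometric_def
  proof (intro exI conjI ballI)
    show "bij_betw (h \<circ> f) X (h ` A)"
      using f(1) inj by (auto intro!: bij_betw_trans[OF f(1)] inj_on_imp_bij_betw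
          intro: inj_on_subset simp: W_def)
    show "d ((h \<circ> f) x) ((h \<circ> f) x') = dX x x'" if "x \<in> X" "x' \<in> X" for x x'
      using that f(2) fA by (subst o_def, subst o_def, subst d) (auto simp: W_def)
  qed
  moreover have "isometric Y dY (h ` B) d"
    unfolding isometric_def
  proof (intro exI conjI ballI)
    show "bij_betw (h \<circ> g) Y (h ` B)"
      using g(1) inj by (auto intro!: bij_betw_trans[OF g(1)] inj_on_imp_bij_betw
          intro: inj_on_subset simp: W_def)
    show "d ((h \<circ> g) x) ((h \<circ> g) x') = dY x x'" if "x \<in> Y" "x' \<in> Y" for x x'
      using that g(2) gB by (subst o_def, subst o_def, subst d) (auto simp: W_def)
  qed
  ultimately have "realization X dX Y dY (h ` W) d (h ` A) (h ` B)"
    by (auto simp: realization_def W_def)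
  moreover have "hausdorff_distance d (h ` A) (h ` B) = hausdorff_distance e A B"
  proof -
    have "d (h a) (h b) = e a b" if "a \<in> A" "b \<in> B" for a b
      using that by (simp add: W_def)
    then show ?thesis
      unfolding hausdorff_distance_def image_image
      by (intro arg_cong2[where f = max] SUP_cong INF_cong) auto
  qed
  ultimately show ?thesis
    unfolding gromov_hausdorff_distance_def by (metis (mono_tags, lifting) Inf_lower mem_Collect_eq)
qed


section \<open>Simplices\<close>

text \<open>The simplex \<open>\<lambda>\<Delta>\<^sub>m\<close> is the carrier \<open>{..<m}\<close> with the following distance.\<close>

definition simplex_dist :: "real \<Rightarrow> nat \<Rightarrow> nat \<Rightarrow> real" where
  "simplex_dist l i j = (if i = j then 0 else l)"

lemma Metric_space_simplex: "0 < l \<Longrightarrow> Metric_space {..<m} (simplex_dist l)"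
  by unfold_locales (auto simp: simplex_dist_def)


section \<open>Partitions and the mst-spectrum\<close>

definition partitions :: "nat \<Rightarrow> 'a set \<Rightarrow> 'a set set set" where
  "partitions k X = {D. partition_on X D \<and> finite D \<and> card D = k}"

definition partition_diam :: "'a::metric_space set set \<Rightarrow> real" where
  "partition_diam D = Max (diameter ` D)"

text \<open>Only meaningful for finite partitions with at least two blocks.\<close>

definition partition_alpha :: "'a::metric_space set set \<Rightarrow> real" where
  "partition_alpha D = Min {setdist A B | A B. A \<in> D \<and> B \<in> D \<and> A \<noteq> B}"

text \<open>The supremum is over a set bounded above whenever \<open>X\<close> is bounded and \<open>k \<ge> 1\<close>.\<close>

definition mst_spectrum :: "'a::metric_space set \<Rightarrow> nat \<Rightarrow> real" where
  "mst_spectrum X k =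
     (if partitions (k + 1) X \<noteq> {} then SUP D\<in>partitions (k + 1) X. partition_alpha D else 0)"

text \<open>In \<^typ>\<open>ennreal\<close> the infimum of the empty set is \<open>\<infinity>\<close>, as required when there is no
  partition into \<open>m\<close> blocks.\<close>

definition partition_diam_inf :: "nat \<Rightarrow> 'a::metric_space set \<Rightarrow> ennreal" where
  "partition_diam_inf m X = (INF D\<in>partitions m X. ennreal (partition_diam D))"

end

theory Submission
  imports Defs
begin

text \<open>Write \<open>\<delta>\<close> for the diameter of \<open>X\<close>. Both inequalities translate between partitions of \<open>X\<close>
  and ways of matching \<open>X\<close> with the vertices of the simplex.

  For \<open>\<le>\<close>, a partition \<open>D\<close> of \<open>X\<close> into \<open>k + 1\<close> blocks gives the correspondence that relates each
  vertex to all points of one block. Two points of the same block are compared with the distance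
  \<open>0\<close>, two points of different blocks with \<open>\<lambda>\<close>, so the distortion is at most the maximum of \<open>\<delta>\<close>
  and \<open>\<lambda> - \<alpha>(D)\<close>. As \<open>\<lambda> - \<delta> < \<sigma>\<^sub>k\<close>, some \<open>D\<close> has \<open>\<alpha>(D) > \<lambda> - \<delta>\<close>, and then the distortion is at
  most \<open>\<delta>\<close>. Half the distortion bounds the Gromov--Hausdorff distance, because a correspondence
  can be used to glue the two spaces together (\<open>gromov_hausdorff_distance_le_distortion\<close>).

  For \<open>\<ge>\<close>, suppose that \<open>X\<close> and the simplex lie in a common space at Hausdorff distance less than
  \<open>r\<close>. Sending each point of \<open>X\<close> to a vertex closer than \<open>r\<close> cuts \<open>X\<close> into at most \<open>k + 1\<close> pieces
  of diameter at most \<open>2r\<close>. Vertices may remain unused, but \<open>X\<close> has enough points to refine the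
  pieces to exactly \<open>k + 1\<close> blocks (\<open>partition_refinement\<close>). Hence \<open>d\<^sub>k\<^sub>+\<^sub>1(X) \<le> 2r\<close>, where the
  left-hand side is \<open>\<delta>\<close> by hypothesis.\<close>


section \<open>Gluing along a correspondence\<close>

text \<open>Corresponding points are joined by edges of length \<open>s\<close>, and points of different spaces get
  the length of a shortest path that uses one edge.\<close>

fun glue_dist ::
  "('a \<Rightarrow> 'a \<Rightarrow> real) \<Rightarrow> ('b \<Rightarrow> 'b \<Rightarrow> real) \<Rightarrow> ('a \<times> 'b) set \<Rightarrow> real \<Rightarrow> 'a + 'b \<Rightarrow> 'a + 'b \<Rightarrow> real"
where
  "glue_dist dX dY R s (Inl x) (Inl x') = dX x x'"
| "glue_dist dX dY R s (Inr y) (Inr y') = dY y y'"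
| "glue_dist dX dY R s (Inl x) (Inr y) = (INF (a, b)\<in>R. dX x a + s + dY b y)"
| "glue_dist dX dY R s (Inr y) (Inl x) = (INF (a, b)\<in>R. dX x a + s + dY b y)"

text \<open>The bound on the distortion says that a path crossing back and forth, whose two edges cost
  \<open>2s\<close>, is no shortcut between two points of the same space. Positivity of \<open>s\<close> keeps points of
  different spaces apart.\<close>

lemma Metric_space_glue_dist:
  assumes X: "Metric_space X dX" and Y: "Metric_space Y dY"
    and R: "R \<subseteq> X \<times> Y" "R \<noteq> {}" and s: "0 < s"
    and distortion: "\<And>a b a' b'. (a, b) \<in> R \<Longrightarrow> (a', b') \<in> R \<Longrightarrow> \<bar>dX a a' - dY b b'\<bar> \<le> 2 * s"
  shows "Metric_space (X <+> Y) (glue_dist dX dY R s)"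
proof -
  interpret X: Metric_space X dX by (rule X)
  interpret Y: Metric_space Y dY by (rule Y)
  let ?d = "glue_dist dX dY R s"
  have cross_le: "?d (Inl x) (Inr y) \<le> dX x a + s + dY b y" if "(a, b) \<in> R" for x y a b
  proof -
    have "bdd_below ((\<lambda>(a, b). dX x a + s + dY b y) ` R)"
      using s by (intro bdd_belowI2[where m = 0]) auto
    from cINF_lower[OF this that] show ?thesis by simp
  qed
  have cross_ge: "c \<le> ?d (Inl x) (Inr y)"
    if "\<And>a b. (a, b) \<in> R \<Longrightarrow> c \<le> dX x a + s + dY b y" for c x y
    using R(2) that by (auto intro!: cINF_greatest)
  have cross_pos: "0 < ?d (Inl x) (Inr y)" for x y
    using cross_ge[of s x y] s by fastforce
  have cross_add_ge: "c \<le> ?d (Inl x) (Inr y) + ?d (Inl x') (Inr y')"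
    if *: "\<And>a b a' b'. (a, b) \<in> R \<Longrightarrow> (a', b') \<in> R \<Longrightarrow>
          c \<le> (dX x a + s + dY b y) + (dX x' a' + s + dY b' y')" for c x y x' y'
  proof -
    have "c - ?d (Inl x') (Inr y') \<le> ?d (Inl x) (Inr y)"
    proof (rule cross_ge)
      fix a b assume ab: "(a, b) \<in> R"
      have "c - (dX x a + s + dY b y) \<le> ?d (Inl x') (Inr y')"
        by (rule cross_ge) (use *[OF ab] in \<open>force simp: algebra_simps\<close>)
      then show "c - ?d (Inl x') (Inr y') \<le> dX x a + s + dY b y" by linarith
    qed
    then show ?thesis by linarith
  qed
  have swap: "?d (Inr y) (Inl x) = ?d (Inl x) (Inr y)" for x y by simp
  have XX: "dX x x' \<le> ?d (Inl x) (Inr y) + ?d (Inl x') (Inr y)"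
    if "x \<in> X" "x' \<in> X" "y \<in> Y" for x x' y
  proof (rule cross_add_ge)
    fix a b a' b' assume ab: "(a, b) \<in> R" "(a', b') \<in> R"
    then have "a \<in> X" "a' \<in> X" "b \<in> Y" "b' \<in> Y" using R(1) by auto
    then show "dX x x' \<le> (dX x a + s + dY b y) + (dX x' a' + s + dY b' y)"
      using distortion[OF ab] that X.triangle[of x a x'] X.triangle[of a a' x']
        Y.triangle[of b y b'] X.commute[of x' a'] Y.commute[of y b'] by linarith
  qed
  have YY: "dY y y' \<le> ?d (Inl x) (Inr y) + ?d (Inl x) (Inr y')"
    if "x \<in> X" "y \<in> Y" "y' \<in> Y" for x y y'
  proof (rule cross_add_ge)
    fix a b a' b' assume ab: "(a, b) \<in> R" "(a', b') \<in> R"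
    then have "a \<in> X" "a' \<in> X" "b \<in> Y" "b' \<in> Y" using R(1) by auto
    then show "dY y y' \<le> (dX x a + s + dY b y) + (dX x a' + s + dY b' y')"
      using distortion[OF ab] that Y.triangle[of y b y'] Y.triangle[of b b' y']
        X.triangle[of a x a'] Y.commute[of y b] X.commute[of x a] by linarith
  qed
  have XXY: "?d (Inl x) (Inr y) \<le> dX x x' + ?d (Inl x') (Inr y)"
    if "x \<in> X" "x' \<in> X" "y \<in> Y" for x x' y
  proof -
    have "?d (Inl x) (Inr y) - dX x x' \<le> ?d (Inl x') (Inr y)"
    proof (rule cross_ge)
      fix a b assume ab: "(a, b) \<in> R"
      then have "a \<in> X" using R(1) by auto
      then show "?d (Inl x) (Inr y) - dX x x' \<le> dX x' a + s + dY b y"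
        using cross_le[OF ab, of x y] X.triangle[of x x' a] that by linarith
    qed
    then show ?thesis by linarith
  qed
  have XYY: "?d (Inl x) (Inr y) \<le> ?d (Inl x) (Inr y') + dY y' y"
    if "x \<in> X" "y \<in> Y" "y' \<in> Y" for x y y'
  proof -
    have "?d (Inl x) (Inr y) - dY y' y \<le> ?d (Inl x) (Inr y')"
    proof (rule cross_ge)
      fix a b assume ab: "(a, b) \<in> R"
      then have "b \<in> Y" using R(1) by auto
      then show "?d (Inl x) (Inr y) - dY y' y \<le> dX x a + s + dY b y'"
        using cross_le[OF ab, of x y] Y.triangle[of b y' y] that by linarith
    qed
    then show ?thesis by linarith
  qed
  have XXY': "?d (Inl x) (Inr y) \<le> ?d (Inl x') (Inr y) + dX x' x"
    if "x \<in> X" "x' \<in> X" "y \<in> Y" for x x' y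
    using XXY[OF that] X.commute[of x x'] by linarith
  have XYY': "?d (Inl x) (Inr y) \<le> dY y y' + ?d (Inl x) (Inr y')"
    if "x \<in> X" "y \<in> Y" "y' \<in> Y" for x y y'
    using XYY[OF that] Y.commute[of y y'] by linarith
  note cross_simps [simp del] = glue_dist.simps(3,4)
  show ?thesis
  proof
    show "0 \<le> ?d u v" for u v
      using cross_pos by (cases u; cases v) (auto simp: swap intro: less_imp_le)
    show "?d u v = ?d v u" for u v
      by (cases u; cases v) (auto simp: swap X.commute Y.commute)
    show "?d u v = 0 \<longleftrightarrow> u = v" if "u \<in> X <+> Y" "v \<in> X <+> Y" for u v
      using that cross_pos by (cases u; cases v) (auto simp: swap less_imp_neq[symmetric])
    show "?d u w \<le> ?d u v + ?d v w" if "u \<in> X <+> Y" "v \<in> X <+> Y" "w \<in> X <+> Y" for u v w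
      using that
      by (cases u; cases v; cases w)
        (auto simp: swap X.triangle Y.triangle XX YY XXY XYY XXY' XYY')
  qed
qed

lemma gromov_hausdorff_distance_le_distortion:
  assumes X: "Metric_space X dX" and Y: "Metric_space Y dY"
    and R: "R \<subseteq> X \<times> Y" "R \<noteq> {}" "X \<subseteq> Domain R" "Y \<subseteq> Range R" and s: "0 < s"
    and distortion: "\<And>a b a' b'. (a, b) \<in> R \<Longrightarrow> (a', b') \<in> R \<Longrightarrow> \<bar>dX a a' - dY b b'\<bar> \<le> 2 * s"
  shows "gromov_hausdorff_distance X dX Y dY \<le> ennreal s"
proof -
  interpret X: Metric_space X dX by (rule X)
  interpret Y: Metric_space Y dY by (rule Y)
  let ?d = "glue_dist dX dY R s"
  have "isometric X dX (Inl ` X) ?d"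
    unfolding isometric_def by (intro exI[of _ Inl]) (auto simp: bij_betw_def)
  moreover have "isometric Y dY (Inr ` Y) ?d"
    unfolding isometric_def by (intro exI[of _ Inr]) (auto simp: bij_betw_def)
  ultimately have "realization X dX Y dY (X <+> Y) ?d (Inl ` X) (Inr ` Y)"
    using Metric_space_glue_dist[OF X Y R(1,2) s distortion] by (auto simp: realization_def)
  moreover have "hausdorff_distance ?d (Inl ` X) (Inr ` Y) \<le> ennreal s"
  proof -
    have edge: "?d (Inl a) (Inr b) \<le> s" if "(a, b) \<in> R" for a b
    proof -
      have "bdd_below ((\<lambda>(x, y). dX a x + s + dY y b) ` R)"
        using s by (intro bdd_belowI2[where m = 0]) auto
      from cINF_lower[OF this that] show ?thesis
        using that R(1) by auto
    qed
    have "(INF v\<in>Inr ` Y. ennreal (?d (Inl x) v)) \<le> ennreal s" if x: "x \<in> X" for x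
    proof -
      obtain y where "(x, y) \<in> R" using R(3) x by blast
      then show ?thesis
        using R(1) by (intro INF_lower2[of "Inr y"] ennreal_leI edge) auto
    qed
    moreover have "(INF u\<in>Inl ` X. ennreal (?d u (Inr y))) \<le> ennreal s" if y: "y \<in> Y" for y
    proof -
      obtain x where "(x, y) \<in> R" using R(4) y by blast
      then show ?thesis
        using R(1) by (intro INF_lower2[of "Inl x"] ennreal_leI edge) auto
    qed
    ultimately show ?thesis
      unfolding hausdorff_distance_def by (auto intro!: SUP_least simp del: glue_dist.simps)
  qed
  ultimately show ?thesis
    using gromov_hausdorff_distance_le order_trans by blast
qed

section \<open>From close realizations to partitions\<close>

text \<open>As long as there are fewer blocks than points, some block has two points, and one of them
  can be split off.\<close>

lemma partition_refinement:
  assumes "D \<in> partitions n X" "n \<le> m" "infinite X \<or> m \<le> card X"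
  shows "\<exists>D'\<in>partitions m X. \<forall>B\<in>D'. \<exists>C\<in>D. B \<subseteq> C"
  using assms(2,3)
proof (induction rule: dec_induct)
  case base
  then show ?case using assms(1) by blast
next
  case (step j)
  from step.prems have "infinite X \<or> j \<le> card X" by linarith
  from step.IH[OF this] obtain E
    where E: "E \<in> partitions j X" "\<forall>B\<in>E. \<exists>C\<in>D. B \<subseteq> C" by (rule bexE)
  have part: "partition_on X E" and fin: "finite E" and card: "card E = j"
    using E(1) by (auto simp: partitions_def)
  have "\<exists>B\<in>E. \<exists>a\<in>B. \<exists>b\<in>B. a \<noteq> b"
  proof (rule ccontr)
    assume small': "\<not> (\<exists>B\<in>E. \<exists>a\<in>B. \<exists>b\<in>B. a \<noteq> b)"
    have small: "finite B \<and> card B \<le> 1" if "B \<in> E" for B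
    proof -
      \<comment> \<open>If \<open>B\<close> is empty, the chosen point is arbitrary and the inclusion still holds.\<close>
      have "B \<subseteq> {SOME x. x \<in> B}" using that small' someI[of "\<lambda>x. x \<in> B"] by blast
      then show ?thesis using card_mono[of "{SOME x. x \<in> B}" B] finite_subset by fastforce
    qed
    have X: "X = \<Union>E" using part by (simp add: partition_on_def)
    have "finite X" unfolding X using small fin by (intro finite_Union) auto
    moreover have "card X \<le> j"
    proof -
      have "card X \<le> sum card E" unfolding X by (rule card_Union_le_sum_card)
      also have "\<dots> \<le> (\<Sum>B\<in>E. 1)" using small by (intro sum_mono) auto
      finally show ?thesis using card by simp
    qed
    ultimately show False using step.prems by simp
  qed
  then obtain B a b where B: "B \<in> E" and ab: "a \<in> B" "b \<in> B" "a \<noteq> b" by blast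
  let ?F = "insert {a} (insert (B - {a}) (E - {B}))"
  have X: "X = \<Union>E" and disj: "\<And>C C'. C \<in> E \<Longrightarrow> C' \<in> E \<Longrightarrow> C \<noteq> C' \<Longrightarrow> C \<inter> C' = {}" and
    ne: "{} \<notin> E"
    using part by (auto simp: partition_on_def disjoint_def)
  have away: "B \<inter> C = {}" if "C \<in> E - {B}" for C using disj[of B C] that B by blast
  have "partition_on X ?F"
  proof (rule partition_onI)
    show "\<Union>?F = X" using X B ab by blast
    show "{} \<notin> ?F" using ne ab by auto
    show "disjnt C C'" if "C \<in> ?F" "C' \<in> ?F" "C \<noteq> C'" for C C'
      using that away disj ab unfolding disjnt_def by blast
  qed
  moreover have "card ?F = Suc j"
  proof -
    have "B - {a} \<notin> E - {B}" using away[of "B - {a}"] ab by blast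
    moreover have "{a} \<notin> insert (B - {a}) (E - {B})" using away[of "{a}"] ab by blast
    moreover have "card (E - {B}) = j - 1" and "0 < j"
      using B fin card card_gt_0_iff[of E] by auto
    ultimately show ?thesis using fin by simp
  qed
  ultimately have "?F \<in> partitions (Suc j) X" using fin by (simp add: partitions_def)
  moreover have "\<forall>C\<in>?F. \<exists>C'\<in>D. C \<subseteq> C'"
  proof -
    obtain C where "C \<in> D" "B \<subseteq> C" using E(2) B by blast
    then show ?thesis using E(2) ab by blast
  qed
  ultimately show ?case by blast
qed

text \<open>Every point of \<open>X\<close> has a point of \<open>S\<close> closer than \<open>r\<close> in the common space. Points with the
  same choice are less than \<open>2 * r\<close> apart, so the fibres of the choice, refined to \<open>m\<close> blocks, form
  a partition of small diameter.\<close>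

lemma partition_diam_inf_le_of_realization:
  fixes X :: "'a::metric_space set"
  assumes real: "realization S dS X dist Z d A B" and H: "hausdorff_distance d A B < ennreal r"
    and S: "finite S" "card S \<le> m" and X: "X \<noteq> {}" "infinite X \<or> m \<le> card X"
  shows "partition_diam_inf m X \<le> ennreal (2 * r)"
proof -
  interpret Metric_space Z d using real by (simp add: realization_def)
  obtain f g where f: "bij_betw f S A" and g: "bij_betw g X B"
    and iso: "\<And>x y. x \<in> X \<Longrightarrow> y \<in> X \<Longrightarrow> d (g x) (g y) = dist x y" and Z: "A \<subseteq> Z" "B \<subseteq> Z"
    using real unfolding realization_def isometric_def by blast
  have "\<exists>i\<in>S. d (f i) (g x) < r" if x: "x \<in> X" for x
  proof -
    have "g x \<in> B" using g x by (auto simp: bij_betw_def)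
    then have "(INF a\<in>A. ennreal (d a (g x))) \<le> hausdorff_distance d A B"
      unfolding hausdorff_distance_def by (intro max.coboundedI2 SUP_upper)
    then have "(INF a\<in>A. ennreal (d a (g x))) < ennreal r" using H by simp
    then obtain a where "a \<in> A" "ennreal (d a (g x)) < ennreal r" by (auto simp: INF_less_iff)
    then show ?thesis using f by (auto simp: bij_betw_def ennreal_less_iff)
  qed
  then obtain c where c: "\<And>x. x \<in> X \<Longrightarrow> c x \<in> S" "\<And>x. x \<in> X \<Longrightarrow> d (f (c x)) (g x) < r"
    by metis
  let ?D = "(\<lambda>i. {x \<in> X. c x = i}) ` c ` X"
  have cS: "c ` X \<subseteq> S" using c(1) by auto
  have "partition_on X ?D"
    by (rule partition_onI) (auto simp: disjnt_def)
  moreover have "finite ?D" using cS S(1) finite_subset by blast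
  moreover have "card ?D \<le> m"
    using card_image_le[of "c ` X"] card_mono[OF S(1) cS] S(2) finite_subset[OF cS S(1)]
    by (meson order_trans)
  ultimately obtain E where E: "E \<in> partitions m X" "\<forall>C\<in>E. \<exists>C'\<in>?D. C \<subseteq> C'"
    using partition_refinement[of ?D "card ?D" X m] X(2) by (auto simp: partitions_def)
  have "diameter C \<le> 2 * r" if C: "C \<in> E" for C
  proof -
    have close: "dist x y \<le> 2 * r" if "x \<in> C" "y \<in> C" for x y
    proof -
      obtain i where "C \<subseteq> {x \<in> X. c x = i}" using E(2) C by blast
      then have xy: "x \<in> X" "y \<in> X" "c x = c y" using that by auto
      have "f (c x) \<in> Z" "g x \<in> Z" "g y \<in> Z"
        using c(1)[OF xy(1)] xy f g Z by (auto simp: bij_betw_def)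
      then have "dist x y \<le> d (f (c x)) (g x) + d (f (c x)) (g y)"
        using triangle[of "g x" "f (c x)" "g y"] iso xy commute by metis
      then show ?thesis using c(2)[OF xy(1)] c(2)[OF xy(2)] xy(3) by simp
    qed
    have "C \<noteq> {}" using E(1) C by (auto simp: partitions_def partition_on_def)
    then show ?thesis
      unfolding diameter_def using close by (auto intro!: cSUP_least)
  qed
  moreover have "finite E" "E \<noteq> {}" using E(1) X(1) by (auto simp: partitions_def partition_on_def)
  ultimately have "partition_diam E \<le> 2 * r" by (simp add: partition_diam_def)
  then show ?thesis
    unfolding partition_diam_inf_def using E(1) by (intro INF_lower2 ennreal_leI)
qed

lemma partition_diam_inf_le_gromov_hausdorff_distance:
  fixes X :: "'a::metric_space set"
  assumes S: "finite S" "card S \<le> m" and X: "X \<noteq> {}" "infinite X \<or> m \<le> card X"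
  shows "partition_diam_inf m X \<le> 2 * gromov_hausdorff_distance S dS X dist"
proof -
  let ?p = "partition_diam_inf m X"
  have "?p / 2 \<le> hausdorff_distance d A B"
    if real: "realization S dS X dist Z d A B" for Z :: "('b + 'a) set" and d A B
  proof (rule dense_ge)
    fix t assume t: "hausdorff_distance d A B < t"
    show "?p / 2 \<le> t"
    proof (cases t)
      case (real r)
      then have "?p \<le> 2 * t"
        using partition_diam_inf_le_of_realization[OF \<open>realization S dS X dist Z d A B\<close> _ S X, of r] t
        by (simp add: ennreal_mult)
      then show ?thesis
        by (simp add: divide_le_posI_ennreal mult.commute)
    qed simp
  qed
  then have "?p / 2 \<le> gromov_hausdorff_distance S dS X dist"
    unfolding gromov_hausdorff_distance_def by (auto intro!: Inf_greatest)
  then have "2 * (?p / 2) \<le> 2 * gromov_hausdorff_distance S dS X dist"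
    by (rule mult_left_mono) simp
  then show ?thesis by (simp add: ennreal_times_divide mult_divide_eq_ennreal mult.commute)
qed

section \<open>From partitions to correspondences with a simplex\<close>

lemma partition_alpha_le_dist:
  assumes "finite D" "A \<in> D" "B \<in> D" "A \<noteq> B" "x \<in> A" "y \<in> B"
  shows "partition_alpha D \<le> dist x y"
proof -
  have "{setdist A B |A B. A \<in> D \<and> B \<in> D \<and> A \<noteq> B} \<subseteq> (\<lambda>(A, B). setdist A B) ` (D \<times> D)"
    by auto
  then have "finite {setdist A B |A B. A \<in> D \<and> B \<in> D \<and> A \<noteq> B}"
    using assms(1) by (meson finite_SigmaI finite_imageI finite_subset)
  then have "partition_alpha D \<le> setdist A B"
    unfolding partition_alpha_def using assms by (intro Min_le) auto
  also have "\<dots> \<le> dist x y" using assms by (intro setdist_le_dist)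
  finally show ?thesis .
qed

text \<open>Let each vertex correspond to the points of one block. The distance \<open>l\<close> exceeds the distance
  of points in different blocks by at most \<open>l - partition_alpha D\<close>; all other discrepancies are at
  most a distance in \<open>X\<close>.\<close>

lemma gromov_hausdorff_distance_simplex_le:
  fixes X :: "'a::metric_space set"
  assumes X: "bounded X" and m: "2 \<le> m" and l: "0 < l"
    and D: "D \<in> partitions m X" "l \<le> diameter X + partition_alpha D"
  shows "gromov_hausdorff_distance {..<m} (simplex_dist l) X dist \<le> ennreal (diameter X / 2)"
proof -
  have part: "partition_on X D" and fin: "finite D" and card: "card D = m"
    using D(1) by (auto simp: partitions_def)
  obtain h where h: "bij_betw h {..<m} D"
    using ex_bij_betw_nat_finite[OF fin] card by (auto simp: lessThan_atLeast0)
  have hD: "h i \<in> D" if "i < m" for i using h that by (auto simp: bij_betw_def)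
  have hX: "h i \<subseteq> X" "h i \<noteq> {}" if "i < m" for i
    using hD[OF that] part by (auto simp: partition_on_def)
  have h_neq: "h i \<noteq> h j" if "i < m" "j < m" "i \<noteq> j" for i j
    using h that by (auto simp: bij_betw_def inj_on_def)
  have disj: "h i \<inter> h j = {}" if "i < m" "j < m" "i \<noteq> j" for i j
    using hD h_neq part that by (auto simp: partition_on_def disjoint_def)
  have cover: "\<exists>i<m. x \<in> h i" if "x \<in> X" for x
    using that part h by (auto simp: partition_on_def bij_betw_def)
  have diam: "dist x y \<le> diameter X" if "x \<in> X" "y \<in> X" for x y
    using diameter_bounded_bound[OF X that] .
  \<comment> \<open>Gluing needs edges of positive length; two blocks provide two distinct points.\<close>
  have pos: "0 < diameter X"
  proof -
    obtain x y where "x \<in> h 0" "y \<in> h 1" using hX(2)[of 0] hX(2)[of 1] m by auto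
    moreover from this have "0 < dist x y" using disj[of 0 1] m by auto
    moreover have "h 0 \<subseteq> X" "h 1 \<subseteq> X" using hX(1) m by auto
    ultimately show ?thesis using diam[of x y] by (meson less_le_trans subsetD)
  qed
  define R where "R = {(i, x). i < m \<and> x \<in> h i}"
  show ?thesis
  proof (rule gromov_hausdorff_distance_le_distortion[where R = R])
    show "Metric_space {..<m} (simplex_dist l)" by (rule Metric_space_simplex[OF l])
    show "Metric_space X dist"
      by unfold_locales (auto simp: dist_commute dist_triangle)
    show "R \<subseteq> {..<m} \<times> X" using hX(1) by (auto simp: R_def)
    show "R \<noteq> {}" using hX(2)[of 0] m by (auto simp: R_def)
    show "{..<m} \<subseteq> Domain R" using hX(2) by (auto simp: R_def Domain_iff)
    show "X \<subseteq> Range R" using cover by (auto simp: R_def)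
    show "0 < diameter X / 2" using pos by simp
    fix i x j y assume "(i, x) \<in> R" "(j, y) \<in> R"
    then have ij: "i < m" "j < m" "x \<in> h i" "y \<in> h j" by (auto simp: R_def)
    then have xy: "dist x y \<le> diameter X" using diam hX(1) by blast
    show "\<bar>simplex_dist l i j - dist x y\<bar> \<le> 2 * (diameter X / 2)"
    proof (cases "i = j")
      case False
      then have "partition_alpha D \<le> dist x y"
        using hD h_neq ij by (intro partition_alpha_le_dist[OF fin, of "h i" "h j"]) auto
      then show ?thesis using False xy l D(2) by (simp add: simplex_dist_def abs_le_iff)
    qed (use xy in \<open>simp add: simplex_dist_def\<close>)
  qed
qed

section \<open>The distance to a simplex\<close>

theorem theorem4p14:
  fixes X :: "'a::metric_space set" and k :: nat and l :: real
  assumes "compact X"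
    and "1 \<le> k"
    and "infinite X \<or> k + 1 \<le> card X"
    and "0 < l"
    and "l < diameter X + mst_spectrum X k"
    and "partition_diam_inf (k + 1) X = ennreal (diameter X)"
  shows "2 * gromov_hausdorff_distance {..<k + 1} (simplex_dist l) X dist = ennreal (diameter X)"
proof (rule antisym)
  \<comment> \<open>Without partitions the infimum of the diameters would be infinite.\<close>
  have ne: "partitions (k + 1) X \<noteq> {}"
    using assms(6) by (auto simp: partition_diam_inf_def)
  have "l - diameter X < (SUP D\<in>partitions (k + 1) X. partition_alpha D)"
    using assms(5) ne by (simp add: mst_spectrum_def)
  then obtain D where D: "D \<in> partitions (k + 1) X" "l - diameter X < partition_alpha D"
    using ne by (elim less_cSupE) auto
  have "gromov_hausdorff_distance {..<k + 1} (simplex_dist l) X dist \<le> ennreal (diameter X / 2)"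
    using D assms by (intro gromov_hausdorff_distance_simplex_le compact_imp_bounded) auto
  then have "2 * gromov_hausdorff_distance {..<k + 1} (simplex_dist l) X dist
      \<le> 2 * ennreal (diameter X / 2)"
    by (rule mult_left_mono) simp
  also have "\<dots> = ennreal (diameter X)"
    using diameter_ge_0[OF compact_imp_bounded[OF assms(1)]]
    by (simp add: ennreal_mult[symmetric] flip: ennreal_numeral)
  finally show "2 * gromov_hausdorff_distance {..<k + 1} (simplex_dist l) X dist
      \<le> ennreal (diameter X)" .
  have "X \<noteq> {}" using assms(3) by auto
  then show "ennreal (diameter X)
      \<le> 2 * gromov_hausdorff_distance {..<k + 1} (simplex_dist l) X dist"
    using partition_diam_inf_le_gromov_hausdorff_distance[of "{..<k + 1}" "k + 1" X] assms(3,6)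
    by simp
qed

end
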